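(* A group $D_{m,n}^{(k)}$ exists only for a) $k=0$ with $m=n$, $r=1$, or b) $k=1$ with $m=3n$, $r=3$. That is, if $m,n$ are positive integers with $n$ a divisor of $m$, $r=m/n$, and $k\in\{0,1,\ldots,r-1\}$ satisfies both $1+k+k^2\equiv 0\pmod r$ and $1+2k\equiv 0\pmod r$, then either ($r=1$, $m=n$ and $k=0$) or ($r=3$, $m=3n$ and $k=1$).
   Context: The group $D_{m,n}^{(k)}$ is defined ("exists") exactly for triples $(m,n,k)$ where $m,n$ are positive integers with $n\mid m$, $r=m/n$, $k\in\{0,\ldots,r-1\}$, $1+k+k^2\equiv 0\pmod r$ and $1+2k\equiv 0\pmod r$. It is then the subgroup of $SU(3)$ generated by $$E=\begin{pmatrix}0&1&0\\0&0&1\\1&0&0\end{pmatrix},\quad B=\begin{pmatrix}-1&0&0\\0&0&-1\\0&-1&0\end{pmatrix},\quad F=\mathrm{diag}(\epsilon,\epsilon^{k},\epsilon^{-k-1}),\quad G=\mathrm{diag}(1,\epsilon^{-r},\epsilon^{r}),$$ with $\epsilon=\exp(2\pi i/m)$. *)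

theory Defs
  imports "HOL-Analysis.Analysis" "HOL-Algebra.Generated_Groups" "HOL-Number_Theory.Cong"
begin

definition conj_transpose :: "complex^'n^'m \<Rightarrow> complex^'m^'n" where
  "conj_transpose A = (\<chi> i j. cnj (A $ j $ i))"

definition SU3 :: "(complex^3^3) monoid" where
  "SU3 = \<lparr>carrier = {A. conj_transpose A ** A = mat 1 \<and> A ** conj_transpose A = mat 1 \<and> det A = 1},
          monoid.mult = (**), one = mat 1\<rparr>"

definition diag3 :: "complex \<Rightarrow> complex \<Rightarrow> complex \<Rightarrow> complex^3^3" where
  "diag3 a b c = vector [vector [a, 0, 0], vector [0, b, 0], vector [0, 0, c]]"

definition root_of_unity :: "nat \<Rightarrow> complex" where
  "root_of_unity m = exp (2 * of_real pi * \<i> / of_nat m)"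

definition E_mat :: "complex^3^3" where
  "E_mat = vector [vector [0, 1, 0], vector [0, 0, 1], vector [1, 0, 0]]"

definition B_mat :: "complex^3^3" where
  "B_mat = vector [vector [- 1, 0, 0], vector [0, 0, - 1], vector [0, - 1, 0]]"

definition F_mat :: "nat \<Rightarrow> nat \<Rightarrow> complex^3^3" where
  "F_mat m k = (let \<epsilon> = root_of_unity m
     in diag3 \<epsilon> (\<epsilon> ^ k) (\<epsilon> powi (- int k - 1)))"

definition G_mat :: "nat \<Rightarrow> nat \<Rightarrow> complex^3^3" where
  "G_mat m r = (let \<epsilon> = root_of_unity m
     in diag3 1 (\<epsilon> powi (- int r)) (\<epsilon> powi (int r)))"

definition admissible :: "nat \<Rightarrow> nat \<Rightarrow> nat \<Rightarrow> bool" where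
  "admissible m n k \<longleftrightarrow>
     0 < m \<and> 0 < n \<and> n dvd m \<and>
     (let r = m div n in
        k \<in> {0..<r} \<and> [1 + k + k\<^sup>2 = 0] (mod r) \<and> [1 + 2 * k = 0] (mod r))"

text \<open>
  The group \<open>D\<^sub>m\<^sub>,\<^sub>n\<^sup>(\<^sup>k\<^sup>)\<close> is only defined for admissible triples, so it is given
  as a partial function, encoded by its graph: \<open>is_D_group m n k H\<close> says that the group
  exists and is the subgroup \<open>H\<close> of \<open>SU3\<close>.
\<close>

definition is_D_group :: "nat \<Rightarrow> nat \<Rightarrow> nat \<Rightarrow> (complex^3^3) set \<Rightarrow> bool" where
  "is_D_group m n k H \<longleftrightarrow>
     admissible m n k \<and>
     H = generate SU3 {E_mat, B_mat, F_mat m k, G_mat m (m div n)}"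

definition D_group_exists :: "nat \<Rightarrow> nat \<Rightarrow> nat \<Rightarrow> bool" where
  "D_group_exists m n k \<longleftrightarrow> (\<exists>H. is_D_group m n k H)"

lemma conj_transpose_mult: "conj_transpose (A ** B) = conj_transpose B ** conj_transpose A"
  by (simp add: conj_transpose_def matrix_matrix_mult_def vec_eq_iff mult.commute)

lemma conj_transpose_mat_1: "conj_transpose (mat 1) = mat 1"
  by (simp add: conj_transpose_def mat_def vec_eq_iff)

lemma conj_transpose_conj_transpose: "conj_transpose (conj_transpose A) = A"
  by (simp add: conj_transpose_def vec_eq_iff)

lemma group_SU3: "group SU3"
proof (rule groupI)
  fix A B assume "A \<in> carrier SU3" "B \<in> carrier SU3"
  then show "A \<otimes>\<^bsub>SU3\<^esub> B \<in> carrier SU3"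
    unfolding SU3_def
    by (simp add: conj_transpose_mult det_mul)
       (metis matrix_mul_assoc matrix_mul_rid)
next
  fix A assume A: "A \<in> carrier SU3"
  then have "det (conj_transpose A ** A) = 1"
    by (simp add: SU3_def)
  moreover have "det A = 1"
    using A by (simp add: SU3_def)
  ultimately have "det (conj_transpose A) = 1"
    by (simp add: det_mul)
  with A show "\<exists>B\<in>carrier SU3. B \<otimes>\<^bsub>SU3\<^esub> A = \<one>\<^bsub>SU3\<^esub>"
    by (intro bexI[of _ "conj_transpose A"]) (auto simp: SU3_def conj_transpose_conj_transpose)
qed (auto simp: SU3_def conj_transpose_mat_1 matrix_mul_assoc)

lemma norm_root_of_unity: "cnj (root_of_unity m) * root_of_unity m = 1"
  by (simp add: root_of_unity_def exp_cnj flip: exp_add)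

lemma diag3_in_SU3:
  assumes "cnj a * a = 1" "cnj b * b = 1" "cnj c * c = 1" "a * b * c = 1"
  shows "diag3 a b c \<in> carrier SU3"
  using assms
  by (simp add: SU3_def diag3_def conj_transpose_def matrix_matrix_mult_def mat_def
      vec_eq_iff forall_3 sum_3 det_3 mult.commute)

lemma generators_in_SU3:
  "{E_mat, B_mat, F_mat m k, G_mat m r} \<subseteq> carrier SU3"
proof -
  let ?e = "root_of_unity m"
  have u: "cnj (?e powi i) * ?e powi i = 1" for i
  proof -
    have "cnj (?e powi i) = cnj ?e powi i"
      by (simp add: power_int_def)
    then show ?thesis
      using norm_root_of_unity[of m] by (metis power_int_1_left power_int_mult_distrib)
  qed
  have nz: "?e \<noteq> 0"
    by (simp add: root_of_unity_def)
  have "E_mat \<in> carrier SU3" "B_mat \<in> carrier SU3"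
    by (simp_all add: SU3_def E_mat_def B_mat_def conj_transpose_def matrix_matrix_mult_def
        mat_def vec_eq_iff forall_3 sum_3 det_3)
  moreover have "G_mat m r \<in> carrier SU3"
    unfolding G_mat_def Let_def
    by (rule diag3_in_SU3) (use nz u in \<open>simp_all only: flip: power_int_add\<close>, simp_all add: power_int_minus nz)
  moreover have "F_mat m k \<in> carrier SU3"
  proof -
    have p: "?e * ?e ^ k * ?e powi (- int k - 1) = ?e powi (1 + int k + (- int k - 1))"
      by (simp only: power_int_add[OF disjI1[OF nz]] power_int_1_right power_int_of_nat)
    show ?thesis
      unfolding F_mat_def Let_def
      by (rule diag3_in_SU3) (use u[of 1] u[of "int k"] u p in auto)
  qed
  ultimately show ?thesis
    by simp
qed

lemma is_D_group_subgroup: "is_D_group m n k H \<Longrightarrow> subgroup H SU3"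
  using group.generate_is_subgroup[OF group_SU3 generators_in_SU3]
  by (simp add: is_D_group_def)

end

theory Submission
  imports Defs
begin

text \<open>The modulus \<open>r\<close> divides both the quadratic \<open>1 + k + k\<^sup>2\<close>
  and its derivative \<open>1 + 2 * k\<close>, hence also the discriminant -3
  (\<open>dvd_3_if_dvd_quadratic_and_derivative\<close>). As 3 is prime, \<open>r\<close> is 1 or 3,
  and the range \<open>k < r\<close> leaves one \<open>k\<close> in each case.\<close>

lemma dvd_3_if_dvd_quadratic_and_derivative:
  fixes r k :: nat
  assumes "r dvd 1 + k + k\<^sup>2" "r dvd 1 + 2 * k"
  shows "r dvd 3"
proof -
  \<comment> \<open>Completing the square, written as a sum so that no subtraction on
    \<open>nat\<close> occurs.\<close>
  have "4 * (1 + k + k\<^sup>2) = (1 + 2 * k) * (1 + 2 * k) + 3"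
    by (simp add: algebra_simps power2_eq_square)
  moreover have "r dvd 4 * (1 + k + k\<^sup>2)" "r dvd (1 + 2 * k) * (1 + 2 * k)"
    using assms by (simp_all only: dvd_mult)
  ultimately show ?thesis
    by (metis dvd_add_right_iff)
qed

theorem theorem4:
  fixes m n k :: nat
  assumes "D_group_exists m n k"
  shows "(k = 0 \<and> m = n \<and> m div n = 1) \<or> (k = 1 \<and> m = 3 * n \<and> m div n = 3)"
proof -
  define r where "r = m div n"
  have "n dvd m" "k < r" and dvd: "r dvd 1 + k + k\<^sup>2" "r dvd 1 + 2 * k"
    using assms
    by (simp_all add: D_group_exists_def is_D_group_def admissible_def Let_def r_def cong_0_iff)
  then have m: "m = r * n"
    by (simp add: r_def)
  have "prime (3 :: nat)"
    by simp
  with dvd_3_if_dvd_quadratic_and_derivative[OF dvd] consider "r = 1" | "r = 3"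
    by (auto simp: prime_nat_iff)
  then show ?thesis
  proof cases
    case 1
    with \<open>k < r\<close> m r_def[symmetric] show ?thesis
      by simp
  next
    case 2
    have "k = 1"
      \<comment> \<open>For \<open>k\<close> = 0, 1, 2 the value \<open>1 + 2 * k\<close> is 1, 3,
        5; only 3 is divisible by 3.\<close>
      using \<open>k < r\<close> dvd(2) unfolding 2 by presburger
    with 2 m r_def[symmetric] show ?thesis
      by simp
  qed
qed

end
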